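(* Let $r$ and $y$ be positive integers and put $S_r(y)=\sum_{j=1}^{y-1}j^r$. If $r$ is odd, then $$S_r(y)\equiv 0 \pmod{\tfrac{y(y-1)}{2}}.$$ If $r$ is even, then $$S_r(y)\equiv -\sum_{\substack{p \text{ prime}\\ (p-1)\mid r,\ p\mid y}}\frac{y}{p} \pmod y,$$ where the sum is over the primes $p$ such that both $p-1$ divides $r$ and $p$ divides $y$.
   Context: For $y=1$ the sum $S_r(y)$ is empty and equals $0$. *)

theory Defs
  imports "HOL-Number_Theory.Number_Theory"
begin

definition S :: "nat \<Rightarrow> nat \<Rightarrow> nat"
  where "S r y = (\<Sum>j = 1..<y. j ^ r)"

end

theory Submission
  imports Defs
begin

text \<open>
  For odd \<open>r\<close>, pairing \<open>j\<close> with \<open>y - j\<close> shows that \<open>y\<close> divides \<open>2 S\<^sub>r(y)\<close>, because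
  \<open>a + b\<close> divides \<open>a\<^sup>r + b\<^sup>r\<close>. The same fact for \<open>y - 1\<close> shows that \<open>y - 1\<close> divides
  \<open>2 S\<^sub>r(y)\<close>, and the two divisors are coprime.

  For even \<open>r\<close>, write \<open>Q(y)\<close> for the sum of the quotients \<open>y / p\<close> in the theorem; the claim
  \<open>S\<^sub>r(y) \<equiv> - Q(y) (mod y)\<close> follows by induction on \<open>y\<close>, removing one prime factor \<open>p\<close>
  from \<open>y = p n\<close> at each step. The range below \<open>p n\<close> consists of \<open>p\<close> blocks of length \<open>n\<close>.

  If \<open>p\<close> divides \<open>n\<close>, then both sides are multiplied by \<open>p\<close>. For \<open>Q\<close> the reason is that
  \<open>p n\<close> and \<open>n\<close> have the same prime divisors. For \<open>S\<^sub>r\<close>, expand \<open>(j + a n)\<^sup>r\<close> to first order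
  in \<open>a n\<close>: the linear terms add up to a multiple of \<open>r n p (p - 1) / 2\<close>, which vanishes
  modulo \<open>p n\<close> because \<open>r\<close> is even (lemma \<open>S_even_mult_cong\<close>).

  If \<open>p\<close> does not divide \<open>n\<close>, then \<open>Q\<close> acquires the new summand \<open>n\<close>, provided that \<open>p - 1\<close>
  divides \<open>r\<close>, and the congruence is checked modulo \<open>n\<close> and modulo \<open>p\<close> separately. By
  periodicity \<open>S\<^sub>r(p n)\<close> is \<open>p S\<^sub>r(n)\<close> modulo \<open>n\<close>, where the new summand vanishes and the
  induction hypothesis applies. Modulo \<open>p\<close> it is \<open>n S\<^sub>r(p)\<close>, where only the new summand
  survives in \<open>Q\<close>; here \<open>S\<^sub>r(p)\<close> is \<open>-1\<close> or \<open>0\<close> according to whether \<open>p - 1\<close> divides \<open>r\<close>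
  (lemma \<open>S_prime_cong\<close>), by Fermat's theorem and the existence of a primitive root.
\<close>

section \<open>Odd exponents\<close>

lemma add_dvd_power_add_power_odd:
  fixes a b :: int
  assumes "odd r"
  shows "a + b dvd a ^ r + b ^ r"
proof -
  have "a - (-b) dvd a ^ r - (-b) ^ r"
    by (metis dvd_triv_left power_diff_sumr2)
  then show ?thesis
    using assms by simp
qed

text \<open>
  Including \<open>j = 0\<close> is harmless for a positive exponent and makes the range split evenly
  into blocks of residues.
\<close>
lemma int_S_eq_sum_lessThan:
  assumes "r > 0"
  shows "int (S r y) = (\<Sum>j<y. int j ^ r)"
proof -
  have "(\<Sum>j<y. int j ^ r) = (\<Sum>j = 1..<y. int j ^ r)"
    using assms by (intro sum.mono_neutral_right) (auto simp: not_le)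
  then show ?thesis
    by (simp add: S_def)
qed

text \<open>Reflecting \<open>j\<close> to \<open>y - j\<close> pairs summands whose bases add up to \<open>y\<close>.\<close>
lemma dvd_twice_S_odd:
  assumes "odd r"
  shows "int y dvd 2 * int (S r y)"
proof -
  have "(\<Sum>j = 1..<y. int j ^ r) = (\<Sum>j = 1..<y. int (y - j) ^ r)"
    by (rule sum.reindex_bij_witness[of _ "\<lambda>j. y - j" "\<lambda>j. y - j"]) auto
  then have "2 * int (S r y) = (\<Sum>j = 1..<y. int j ^ r + int (y - j) ^ r)"
    by (simp add: S_def sum.distrib)
  also have "int y dvd \<dots>"
  proof (rule dvd_sum)
    fix j assume "j \<in> {1..<y}"
    then have "int y = int j + int (y - j)" by simp
    then show "int y dvd int j ^ r + int (y - j) ^ r"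
      using add_dvd_power_add_power_odd[OF assms] by metis
  qed
  finally show ?thesis .
qed

text \<open>
  The last summand \<open>(y - 1)\<^sup>r\<close> is a multiple of \<open>y - 1\<close>; the others form the sum to which
  the previous lemma applies with \<open>y - 1\<close> in place of \<open>y\<close>.
\<close>
lemma pred_dvd_twice_S_odd:
  assumes "odd r"
  shows "int (y - 1) dvd 2 * int (S r y)"
proof -
  have "S r y = S r (y - 1) + (y - 1) ^ r"
    using odd_pos[OF assms]
    by (cases "y \<le> 1") (auto simp: S_def not_le dest!: less_imp_Suc_add)
  moreover have "int (y - 1) dvd int (y - 1) ^ r"
    using odd_pos[OF assms] by (simp add: dvd_power)
  ultimately show ?thesis
    using dvd_twice_S_odd[OF assms, of "y - 1"]
    by (simp add: distrib_left dvd_add)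
qed

lemma S_odd_cong:
  assumes "odd r" and "y > 0"
  shows "[S r y = 0] (mod (y * (y - 1) div 2))"
proof -
  have "coprime y (y - 1)"
    using assms(2) by (cases y) simp_all
  moreover have "y dvd 2 * S r y" "y - 1 dvd 2 * S r y"
    using dvd_twice_S_odd[OF assms(1), of y] pred_dvd_twice_S_odd[OF assms(1), of y]
    by (metis int_dvd_int_iff of_nat_mult of_nat_numeral)+
  ultimately have "y * (y - 1) dvd 2 * S r y"
    by (rule divides_mult[rotated 2])
  moreover obtain k where "y * (y - 1) = 2 * k"
  proof -
    have "even (y * (y - 1))"
      using assms(2) by simp
    then show thesis
      using that by blast
  qed
  ultimately show ?thesis
    by (simp add: cong_0_iff)
qed

section \<open>Splitting the range into blocks\<close>

lemma sum_lessThan_mult_blocks: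
  fixes f :: "nat \<Rightarrow> 'a :: comm_monoid_add"
  shows "(\<Sum>i<m * n. f i) = (\<Sum>a<m. \<Sum>j<n. f (j + a * n))"
proof -
  have "(\<Sum>i<m * n. f i) = (\<Sum>a<m. \<Sum>i = a * n..<a * n + n. f i)"
    by (rule sum.nat_group[symmetric])
  also have "\<dots> = (\<Sum>a<m. \<Sum>j<n. f (j + a * n))"
    using sum.shift_bounds_nat_ivl[of f 0 "_ * n" n]
    by (simp add: atLeast0LessThan add.commute)
  finally show ?thesis .
qed

text \<open>Modulo \<open>n\<close> each of the \<open>m\<close> blocks repeats the first one.\<close>
lemma S_mult_cong:
  assumes "r > 0"
  shows "[int (S r (m * n)) = int m * int (S r n)] (mod int n)"
proof -
  have "[(\<Sum>a<m. \<Sum>j<n. int (j + a * n) ^ r) = (\<Sum>a<m. \<Sum>j<n. int j ^ r)] (mod int n)"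
    by (intro cong_sum cong_pow) (simp add: cong_iff_dvd_diff)
  then show ?thesis
    by (simp add: int_S_eq_sum_lessThan assms sum_lessThan_mult_blocks)
qed

lemma power_add_cong_first_order:
  fixes x d :: int
  shows "[(x + d) ^ Suc k = x ^ Suc k + int (Suc k) * d * x ^ k] (mod d\<^sup>2)"
proof (induction k)
  case (Suc k)
  have "[(x + d) * (x + d) ^ Suc k = (x + d) * (x ^ Suc k + int (Suc k) * d * x ^ k)] (mod d\<^sup>2)"
    by (rule cong_scalar_left[OF Suc.IH])
  moreover have "(x + d) * (x ^ Suc k + int (Suc k) * d * x ^ k) =
      (x ^ Suc (Suc k) + int (Suc (Suc k)) * d * x ^ Suc k) + d\<^sup>2 * (int (Suc k) * x ^ k)"
    by (simp add: algebra_simps power2_eq_square)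
  ultimately show ?case
    by (simp add: cong_def)
qed simp

text \<open>
  Periodicity alone gives this congruence only modulo \<open>n\<close>. The first-order terms sum to
  \<open>r n (0 + \<dots> + (m - 1))\<close> times a power sum, and \<open>r / 2\<close> absorbs the denominator of
  \<open>m (m - 1) / 2\<close>. The condition that \<open>m\<close> divides \<open>n\<close> makes the error terms, multiples
  of \<open>n\<^sup>2\<close>, vanish modulo \<open>m n\<close>.
\<close>
lemma S_even_mult_cong:
  assumes "even r" and "r > 0" and "m dvd n"
  shows "[int (S r (m * n)) = int m * int (S r n)] (mod int (m * n))"
proof -
  obtain h where r: "r = 2 * h" "h > 0"
    using assms(1,2) by auto
  have modulus: "int (m * n) dvd (int a * int n)\<^sup>2" for a
    using assms(3) by (auto simp: power2_eq_square)
  have "[int (j + a * n) ^ r = int j ^ r + int r * (int a * int n) * int j ^ (r - 1)]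
      (mod int (m * n))" for j a
    using power_add_cong_first_order[of "int j" "int a * int n" "r - 1"] assms(2)
      cong_dvd_modulus[OF _ modulus] by simp
  then have "[(\<Sum>a<m. \<Sum>j<n. int (j + a * n) ^ r) =
      (\<Sum>a<m. \<Sum>j<n. int j ^ r + int r * (int a * int n) * int j ^ (r - 1))] (mod int (m * n))"
    by (intro cong_sum)
  also have "(\<Sum>a<m. \<Sum>j<n. int j ^ r + int r * (int a * int n) * int j ^ (r - 1)) =
      int m * (\<Sum>j<n. int j ^ r) +
      int h * int n * (2 * (\<Sum>a<m. int a)) * (\<Sum>j<n. int j ^ (r - 1))"
    by (simp add: sum.distrib sum_distrib_left sum_distrib_right r(1) mult_ac)
  also have "2 * (\<Sum>a<m. int a) = int m * (int m - 1)"
    by (induction m) (simp_all add: algebra_simps)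
  finally have "[(\<Sum>a<m. \<Sum>j<n. int (j + a * n) ^ r) = int m * (\<Sum>j<n. int j ^ r) +
      int (m * n) * (int h * (int m - 1) * (\<Sum>j<n. int j ^ (r - 1)))] (mod int (m * n))"
    by (simp add: mult_ac)
  then show ?thesis
    by (simp add: int_S_eq_sum_lessThan assms(2) sum_lessThan_mult_blocks cong_def)
qed

section \<open>Power sums modulo a prime\<close>

text \<open>
  If \<open>p - 1\<close> divides \<open>r\<close>, every summand is \<open>1\<close> by Fermat's theorem. Otherwise,
  multiplication by a primitive root \<open>g\<close> permutes the nonzero residues, so the sum is
  unchanged when multiplied by \<open>g\<^sup>r\<close>; since \<open>g\<^sup>r\<close> is not \<open>1\<close> modulo \<open>p\<close>, the sum is \<open>0\<close>.
\<close>
lemma S_prime_cong: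
  assumes "prime p"
  shows "[int (S r p) = (if (p - 1) dvd r then -1 else 0)] (mod int p)"
proof (cases "(p - 1) dvd r")
  case True
  then obtain k where r: "r = (p - 1) * k" ..
  have "[int j ^ r = 1] (mod int p)" if "j \<in> {1..<p}" for j
  proof -
    have "\<not> p dvd j"
      using that by (auto dest: dvd_imp_le)
    then have "[j ^ (p - 1) = 1] (mod p)"
      by (rule fermat_theorem[OF assms])
    then have "[(j ^ (p - 1)) ^ k = 1 ^ k] (mod p)"
      by (rule cong_pow)
    then show ?thesis
      by (simp add: r power_mult flip: cong_int_iff)
  qed
  then have "[(\<Sum>j = 1..<p. int j ^ r) = (\<Sum>j = 1..<p. 1)] (mod int p)"
    by (intro cong_sum)
  moreover have "[(\<Sum>j = 1..<p. 1) = (-1 :: int)] (mod int p)"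
    using prime_gt_1_nat[OF assms] by (simp add: cong_iff_dvd_diff of_nat_diff)
  ultimately show ?thesis
    using True by (auto simp: S_def intro: cong_trans)
next
  case False
  obtain g where g: "coprime p g" "ord p g = p - 1"
    using prime_primitive_root_exists[OF prime_gt_1_nat[OF assms] assms]
    by (auto simp: residue_primroot_def totient_prime assms)
  let ?T = "\<Sum>j = 1..<int p. j ^ r"
  have S_eq: "int (S r p) = ?T"
    unfolding S_def of_nat_sum
    by (rule sum.reindex_bij_witness[of _ nat int]) auto
  have "?T = (\<Sum>j = 1..<int p. (int g * j mod int p) ^ r)"
    by (rule sum.reindex_bij_betw[symmetric], rule bij_betw_int_remainders_mult)
      (use g(1) in \<open>auto simp: coprime_commute\<close>)
  also have "[\<dots> = (\<Sum>j = 1..<int p. (int g * j) ^ r)] (mod int p)"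
    by (intro cong_sum cong_pow) simp
  also have "(\<Sum>j = 1..<int p. (int g * j) ^ r) = int g ^ r * ?T"
    by (simp add: power_mult_distrib sum_distrib_left)
  finally have "int p dvd (int g ^ r - 1) * ?T"
    by (simp add: cong_iff_dvd_diff algebra_simps dvd_diff_commute)
  moreover have "\<not> int p dvd int g ^ r - 1"
    using False ord_divides[of g r p] g(2) cong_int_iff[of "g ^ r" 1 p]
    by (simp add: cong_iff_dvd_diff)
  ultimately have "int p dvd ?T"
    using assms prime_dvd_mult_iff[of "int p"] by auto
  then show ?thesis
    using False S_eq by (simp add: cong_0_iff)
qed

section \<open>The sum over primes\<close>

definition prime_quotient_sum :: "nat \<Rightarrow> nat \<Rightarrow> int"
  where "prime_quotient_sum r y =
    (\<Sum>p \<in> {p. prime p \<and> (p - 1) dvd r \<and> p dvd y}. int (y div p))"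

text \<open>
  Each prime divisor \<open>q\<close> of \<open>n\<close> contributes \<open>p n / q = p (n / q)\<close>. The prime \<open>p\<close> is an
  additional divisor only if it does not divide \<open>n\<close>, and then it contributes \<open>p n / p = n\<close>.
\<close>
lemma prime_quotient_sum_mult_prime:
  assumes "prime p" and "n > 0"
  shows "prime_quotient_sum r (p * n) = int p * prime_quotient_sum r n +
    (if (p - 1) dvd r \<and> \<not> p dvd n then int n else 0)"
proof -
  let ?P = "\<lambda>y. {q. prime q \<and> (q - 1) dvd r \<and> q dvd y}"
  have fin: "finite (?P n)"
    using assms(2) by (rule_tac finite_subset[OF _ finite_divisors_nat]) auto
  have "?P (p * n) = ?P n \<union> (if (p - 1) dvd r \<and> \<not> p dvd n then {p} else {})"
    using assms(1) by (auto simp: prime_dvd_mult_iff dest: primes_dvd_imp_eq)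
  moreover have "(\<Sum>q \<in> ?P n. int (p * n div q)) = int p * prime_quotient_sum r n"
    unfolding prime_quotient_sum_def sum_distrib_left
    by (rule sum.cong) (auto simp: div_mult_swap simp flip: of_nat_mult)
  ultimately show ?thesis
    unfolding prime_quotient_sum_def[of r "p * n"]
    using fin prime_gt_0_nat[OF assms(1)] by simp
qed

section \<open>Even exponents\<close>

text \<open>
  In the inductive step \<open>y = p n\<close>, the congruence for \<open>n\<close> can be multiplied by \<open>p\<close> together
  with its modulus if \<open>p\<close> divides \<open>n\<close>; otherwise \<open>p\<close> and \<open>n\<close> are coprime and the
  congruences modulo each of them are combined.
\<close>
lemma S_even_cong:
  assumes "even r" and "r > 0" and "y > 0"
  shows "[int (S r y) = - prime_quotient_sum r y] (mod int y)"
  using assms(3)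
proof (induction y rule: less_induct)
  case (less y)
  show ?case
  proof (cases "y = 1")
    case False
    then obtain p where p: "prime p" "p dvd y"
      using prime_factor_nat by blast
    then obtain n where y: "y = p * n" by blast
    have n: "n > 0" "n < y"
      using less.prems prime_gt_1_nat[OF p(1)] by (auto simp: y)
    have IH: "[int (S r n) = - prime_quotient_sum r n] (mod int n)"
      using less.IH n by blast
    note Q = prime_quotient_sum_mult_prime[OF p(1) n(1), of r]
    show ?thesis
    proof (cases "p dvd n")
      case True
      have "[int p * int (S r n) = int p * (- prime_quotient_sum r n)] (mod (int p * int n))"
        using IH by (rule cong_cmult_leftI)
      with S_even_mult_cong[OF assms(1,2) True] show ?thesis
        using True by (auto simp: y Q intro: cong_trans)
    next
      case False
      have "[int (S r (p * n)) = - prime_quotient_sum r (p * n)] (mod int n)"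
      proof -
        have "[int (S r (p * n)) = int p * int (S r n)] (mod int n)"
          by (rule S_mult_cong[OF assms(2)])
        also have "[int p * int (S r n) = int p * (- prime_quotient_sum r n)] (mod int n)"
          by (rule cong_scalar_left[OF IH])
        also have "[int p * (- prime_quotient_sum r n) = - prime_quotient_sum r (p * n)] (mod int n)"
          by (simp add: Q cong_iff_dvd_diff)
        finally show ?thesis .
      qed
      moreover have "[int (S r (p * n)) = - prime_quotient_sum r (p * n)] (mod int p)"
      proof -
        have "[int (S r (p * n)) = int n * int (S r p)] (mod int p)"
          using S_mult_cong[OF assms(2), of n p] by (simp add: mult.commute)
        also have "[int n * int (S r p) = int n * (if (p - 1) dvd r then -1 else 0)] (mod int p)"
          by (rule cong_scalar_left[OF S_prime_cong[OF p(1)]])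
        also have "[int n * (if (p - 1) dvd r then -1 else 0) = - prime_quotient_sum r (p * n)]
            (mod int p)"
          using False by (simp add: Q cong_iff_dvd_diff)
        finally show ?thesis .
      qed
      moreover have "coprime (int p) (int n)"
        using p(1) False by (simp add: prime_imp_coprime)
      ultimately show ?thesis
        by (simp add: y coprime_cong_mult)
    qed
  qed simp
qed

theorem theorem3:
  fixes r y :: nat
  assumes "r > 0" and "y > 0"
  shows "(odd r \<longrightarrow> [S r y = 0] (mod (y * (y - 1) div 2))) \<and>
    (even r \<longrightarrow>
      [int (S r y) = - (\<Sum>p \<in> {p. prime p \<and> (p - 1) dvd r \<and> p dvd y}. int (y div p))] (mod int y))"
  using S_odd_cong[of r y] S_even_cong[of r y] assms
  by (simp add: prime_quotient_sum_def)

end
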